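(* Let $\mu_1,\mu_2\in\mathbb{C}$ with $\mu_1+\mu_2\notin\mathbb{Z}$. The $\mathfrak{sl}_3$-module $M_{\mu_1,\mu_2}$ is simple if and only if $\mu_1\notin\mathbb{Z}$ and $\mu_2\notin\mathbb{Z}$.
   Context: $\mathfrak{sl}_3$ is the complex Lie algebra with root vectors $e_1,e_2,e_{12}=[e_1,e_2]$ (roots $\alpha_1,\alpha_2,\alpha_1+\alpha_2$), $f_1,f_2,f_{12}=-[f_1,f_2]$ (the negative roots), and simple coroots $h_1,h_2$ spanning the Cartan subalgebra $\mathfrak{t}$; e.g. $e_1=E_{12}$, $e_2=E_{23}$, $e_{12}=E_{13}$, $f_1=E_{21}$, $f_2=E_{32}$, $f_{12}=E_{31}$. For $\mu_1,\mu_2\in\mathbb{C}$ the $\mathfrak{sl}_3$-module $M_{\mu_1,\mu_2}$ is the space of global sections of a rank one local system on $O=X_{w_\circ}\cap s_1X_{w_\circ}\cap s_2X_{w_\circ}\cong\mathbb{G}_m^2\times\mathbb{A}^1$ ($X_{w_\circ}$ the big cell of the flag variety of $\mathrm{SL}_3$), on which $\mathfrak{sl}_3$ acts by infinitesimal left translations. Explicitly, write $\overline{k}=k-\mu_1$ and $\overline{l}=l-\mu_2$. Then $M_{\mu_1,\mu_2}$ has the $\mathbb{C}$-basis $u_{k,l,m}$, $k,l\in\mathbb{Z}$, $m\in\mathbb{Z}_{\ge0}$, with action $$e_1u_{k,l,m}=-\overline{k}\,u_{k-1,l,m},\qquad e_2u_{k,l,m}=-\overline{l}\,u_{k,l-1,m}+m\,u_{k+1,l,m-1},$$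 $$h\,u_{k,l,m}=-\big((\overline{k}+m)\alpha_1(h)+(\overline{l}+m)\alpha_2(h)\big)u_{k,l,m}\quad(h\in\mathfrak{t}),$$ $$f_1u_{k,l,m}=(\overline{k}-\overline{l}+m)u_{k+1,l,m}-\overline{l}\,u_{k,l-1,m+1},\qquad f_2u_{k,l,m}=\overline{l}\,u_{k,l+1,m}+\overline{k}\,u_{k-1,l,m+1},$$ $$e_{12}u_{k,l,m}=-m\,u_{k,l,m-1},\qquad f_{12}u_{k,l,m}=(\overline{k}+\overline{l}+m)u_{k,l,m+1}+\overline{l}\,u_{k+1,l+1,m}$$ (terms with coefficient $m=0$ are zero). *)

theory Defs
  imports "HOL-Analysis.Analysis" "HOL-Library.Poly_Mapping"
begin

section \<open>Modules over a Lie algebra of complex matrices\<close>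

definition lie_bracket :: "complex^'n^'n \<Rightarrow> complex^'n^'n \<Rightarrow> complex^'n^'n"
  where "lie_bracket X Y = X ** Y - Y ** X"

definition lie_module ::
    "(complex^'n^'n) set \<Rightarrow> (complex \<Rightarrow> 'v::ab_group_add \<Rightarrow> 'v) \<Rightarrow> (complex^'n^'n \<Rightarrow> 'v \<Rightarrow> 'v) \<Rightarrow> bool"
  where "lie_module L s act \<longleftrightarrow>
     vector_space s \<and>
     (\<forall>X\<in>L. Vector_Spaces.linear s s (act X)) \<and>
     (\<forall>X\<in>L. \<forall>Y\<in>L. \<forall>v. act (X + Y) v = act X v + act Y v) \<and>
     (\<forall>X\<in>L. \<forall>c v. act (map_matrix ((*) c) X) v = s c (act X v)) \<and>
     (\<forall>X\<in>L. \<forall>Y\<in>L. \<forall>v. act (lie_bracket X Y) v = act X (act Y v) - act Y (act X v))"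

definition lie_submodule ::
    "(complex^'n^'n) set \<Rightarrow> (complex \<Rightarrow> 'v::ab_group_add \<Rightarrow> 'v) \<Rightarrow> (complex^'n^'n \<Rightarrow> 'v \<Rightarrow> 'v) \<Rightarrow> 'v set \<Rightarrow> bool"
  where "lie_submodule L s act S \<longleftrightarrow>
     module.subspace s S \<and> (\<forall>X\<in>L. \<forall>v\<in>S. act X v \<in> S)"

definition simple_lie_module ::
    "(complex^'n^'n) set \<Rightarrow> (complex \<Rightarrow> 'v::ab_group_add \<Rightarrow> 'v) \<Rightarrow> (complex^'n^'n \<Rightarrow> 'v \<Rightarrow> 'v) \<Rightarrow> bool"
  where "simple_lie_module L s act \<longleftrightarrow>
     lie_module L s act \<and>
     (\<exists>v::'v. v \<noteq> 0) \<and>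
     (\<forall>S. lie_submodule L s act S \<longrightarrow> S = {0} \<or> S = UNIV)"

definition sl3 :: "(complex^3^3) set"
  where "sl3 = {X. trace X = 0}"


section \<open>The free complex vector space on the indices \<open>(k, l, m)\<close>\<close>

type_synonym M_space = "(int \<times> int \<times> nat) \<Rightarrow>\<^sub>0 complex"

definition M_scale :: "complex \<Rightarrow> M_space \<Rightarrow> M_space"
  where "M_scale c v = Poly_Mapping.map ((*) c) v"

definition u :: "int \<Rightarrow> int \<Rightarrow> nat \<Rightarrow> M_space"
  where "u k l m = Poly_Mapping.single (k, l, m) 1"

definition M_extend :: "(int \<Rightarrow> int \<Rightarrow> nat \<Rightarrow> M_space) \<Rightarrow> M_space \<Rightarrow> M_space"
  where "M_extend f v =
     (\<Sum>(k, l, m)\<in>Poly_Mapping.keys v. M_scale (Poly_Mapping.lookup v (k, l, m)) (f k l m))"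


section \<open>The module \<open>M\<close>\<close>

text \<open>
  The action on the basis, with \<open>kb = k - \<mu>\<^sub>1\<close> and \<open>lb = l - \<mu>\<^sub>2\<close>.
  Where \<open>m - 1\<close> is truncated, i.e. for \<open>m = 0\<close>, its coefficient \<open>m\<close> vanishes.
\<close>

definition M_e1 :: "complex \<Rightarrow> complex \<Rightarrow> int \<Rightarrow> int \<Rightarrow> nat \<Rightarrow> M_space"
  where "M_e1 \<mu>\<^sub>1 \<mu>\<^sub>2 k l m =
    (let kb = of_int k - \<mu>\<^sub>1 in M_scale (- kb) (u (k - 1) l m))"

definition M_e2 :: "complex \<Rightarrow> complex \<Rightarrow> int \<Rightarrow> int \<Rightarrow> nat \<Rightarrow> M_space"
  where "M_e2 \<mu>\<^sub>1 \<mu>\<^sub>2 k l m =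
    (let lb = of_int l - \<mu>\<^sub>2 in
       M_scale (- lb) (u k (l - 1) m) + M_scale (of_nat m) (u (k + 1) l (m - 1)))"

definition M_e12 :: "complex \<Rightarrow> complex \<Rightarrow> int \<Rightarrow> int \<Rightarrow> nat \<Rightarrow> M_space"
  where "M_e12 \<mu>\<^sub>1 \<mu>\<^sub>2 k l m = M_scale (- of_nat m) (u k l (m - 1))"

definition M_f1 :: "complex \<Rightarrow> complex \<Rightarrow> int \<Rightarrow> int \<Rightarrow> nat \<Rightarrow> M_space"
  where "M_f1 \<mu>\<^sub>1 \<mu>\<^sub>2 k l m =
    (let kb = of_int k - \<mu>\<^sub>1; lb = of_int l - \<mu>\<^sub>2 in
       M_scale (kb - lb + of_nat m) (u (k + 1) l m) + M_scale (- lb) (u k (l - 1) (m + 1)))"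

definition M_f2 :: "complex \<Rightarrow> complex \<Rightarrow> int \<Rightarrow> int \<Rightarrow> nat \<Rightarrow> M_space"
  where "M_f2 \<mu>\<^sub>1 \<mu>\<^sub>2 k l m =
    (let kb = of_int k - \<mu>\<^sub>1; lb = of_int l - \<mu>\<^sub>2 in
       M_scale lb (u k (l + 1) m) + M_scale kb (u (k - 1) l (m + 1)))"

definition M_f12 :: "complex \<Rightarrow> complex \<Rightarrow> int \<Rightarrow> int \<Rightarrow> nat \<Rightarrow> M_space"
  where "M_f12 \<mu>\<^sub>1 \<mu>\<^sub>2 k l m =
    (let kb = of_int k - \<mu>\<^sub>1; lb = of_int l - \<mu>\<^sub>2 in
       M_scale (kb + lb + of_nat m) (u k l (m + 1)) + M_scale lb (u (k + 1) (l + 1) m))"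

text \<open>The arguments \<open>a\<^sub>1\<close>, \<open>a\<^sub>2\<close> are the values \<open>\<alpha>\<^sub>1(h)\<close>, \<open>\<alpha>\<^sub>2(h)\<close> of the simple roots.\<close>

definition M_h :: "complex \<Rightarrow> complex \<Rightarrow> complex \<Rightarrow> complex \<Rightarrow> int \<Rightarrow> int \<Rightarrow> nat \<Rightarrow> M_space"
  where "M_h \<mu>\<^sub>1 \<mu>\<^sub>2 a\<^sub>1 a\<^sub>2 k l m =
    (let kb = of_int k - \<mu>\<^sub>1; lb = of_int l - \<mu>\<^sub>2 in
       M_scale (- ((kb + of_nat m) * a\<^sub>1 + (lb + of_nat m) * a\<^sub>2)) (u k l m))"

text \<open>
  A traceless matrix \<open>X\<close> is \<open>X\<^sub>1\<^sub>2 e\<^sub>1 + X\<^sub>2\<^sub>3 e\<^sub>2 + X\<^sub>1\<^sub>3 e\<^sub>1\<^sub>2 + X\<^sub>2\<^sub>1 f\<^sub>1 + X\<^sub>3\<^sub>2 f\<^sub>2 + X\<^sub>3\<^sub>1 f\<^sub>1\<^sub>2 + h\<close>, where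
  \<open>h\<close> is the diagonal part of \<open>X\<close>, so that \<open>\<alpha>\<^sub>1(h) = X\<^sub>1\<^sub>1 - X\<^sub>2\<^sub>2\<close> and \<open>\<alpha>\<^sub>2(h) = X\<^sub>2\<^sub>2 - X\<^sub>3\<^sub>3\<close>.
\<close>

definition M_act_basis :: "complex \<Rightarrow> complex \<Rightarrow> complex^3^3 \<Rightarrow> int \<Rightarrow> int \<Rightarrow> nat \<Rightarrow> M_space"
  where "M_act_basis \<mu>\<^sub>1 \<mu>\<^sub>2 X k l m =
     M_scale (X$1$2) (M_e1 \<mu>\<^sub>1 \<mu>\<^sub>2 k l m) + M_scale (X$2$3) (M_e2 \<mu>\<^sub>1 \<mu>\<^sub>2 k l m)
     + M_scale (X$1$3) (M_e12 \<mu>\<^sub>1 \<mu>\<^sub>2 k l m)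
     + M_scale (X$2$1) (M_f1 \<mu>\<^sub>1 \<mu>\<^sub>2 k l m) + M_scale (X$3$2) (M_f2 \<mu>\<^sub>1 \<mu>\<^sub>2 k l m)
     + M_scale (X$3$1) (M_f12 \<mu>\<^sub>1 \<mu>\<^sub>2 k l m)
     + M_h \<mu>\<^sub>1 \<mu>\<^sub>2 (X$1$1 - X$2$2) (X$2$2 - X$3$3) k l m"

definition M_act :: "complex \<Rightarrow> complex \<Rightarrow> complex^3^3 \<Rightarrow> M_space \<Rightarrow> M_space"
  where "M_act \<mu>\<^sub>1 \<mu>\<^sub>2 X = M_extend (M_act_basis \<mu>\<^sub>1 \<mu>\<^sub>2 X)"


section \<open>\<open>M\<close> is a module over \<open>sl3\<close>\<close>

lemma lookup_M_scale [simp]: "Poly_Mapping.lookup (M_scale c v) i = c * Poly_Mapping.lookup v i"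
  by (simp add: M_scale_def Poly_Mapping.map.rep_eq when_def)

lemma vector_space_M_scale: "vector_space M_scale"
  by unfold_locales (auto intro!: poly_mapping_eqI simp: lookup_add algebra_simps)

interpretation M: vector_space M_scale
  by (rule vector_space_M_scale)

lemma M_extend_superset:
  assumes "finite A" "Poly_Mapping.keys v \<subseteq> A"
  shows "M_extend f v = (\<Sum>(k, l, m)\<in>A. M_scale (Poly_Mapping.lookup v (k, l, m)) (f k l m))"
  unfolding M_extend_def
  by (rule sum.mono_neutral_left) (use assms in \<open>auto simp: in_keys_iff\<close>)

lemma M_extend_add: "M_extend f (v + w) = M_extend f v + M_extend f w"
proof -
  let ?A = "Poly_Mapping.keys v \<union> Poly_Mapping.keys w"
  have "Poly_Mapping.keys (v + w) \<subseteq> ?A" by (rule Poly_Mapping.keys_add)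
  then show ?thesis
    by (simp add: M_extend_superset[of ?A] lookup_add M.scale_left_distrib case_prod_unfold
        sum.distrib)
qed

lemma M_extend_scale: "M_extend f (M_scale c v) = M_scale c (M_extend f v)"
proof -
  have "Poly_Mapping.keys (M_scale c v) \<subseteq> Poly_Mapping.keys v" by (auto simp: in_keys_iff)
  then show ?thesis
    by (simp add: M_extend_superset[of "Poly_Mapping.keys v"] M.scale_sum_right case_prod_unfold)
qed

lemma M_extend_u [simp]: "M_extend f (u k l m) = f k l m"
  by (simp add: M_extend_def u_def)

lemma M_extend_0 [simp]: "M_extend f 0 = 0"
  by (simp add: M_extend_def)

lemma linear_M_extend: "Vector_Spaces.linear M_scale M_scale (M_extend f)"
  by unfold_locales (auto simp: M_extend_add M_extend_scale)

lemma M_extend_neg: "M_extend f (- v) = - M_extend f v"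
  using M_extend_scale[of f "-1" v] by simp

lemma M_extend_diff: "M_extend f (v - w) = M_extend f v - M_extend f w"
  by (metis M_extend_add M_extend_neg diff_conv_add_uminus)

lemma M_extend_id: "M_extend u v = v"
  by (rule poly_mapping_eqI)
    (simp add: M_extend_def u_def case_prod_unfold lookup_sum lookup_single when_def
      if_distrib in_keys_iff sum.delta' cong: if_cong)

lemma M_eqI:
  assumes "Vector_Spaces.linear M_scale M_scale F" "Vector_Spaces.linear M_scale M_scale G"
    and "\<And>k l m. F (u k l m) = G (u k l m)"
  shows "F v = G v"
proof -
  interpret F: Vector_Spaces.linear M_scale M_scale F by fact
  interpret G: Vector_Spaces.linear M_scale M_scale G by fact
  have "F (M_extend u v) = G (M_extend u v)"
    by (simp add: M_extend_def case_prod_unfold F.sum G.sum F.scale G.scale assms(3))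
  then show ?thesis by (simp add: M_extend_id)
qed

lemmas M_basis_defs = M_act_basis_def M_e1_def M_e2_def M_e12_def M_f1_def M_f2_def M_f12_def
  M_h_def Let_def

lemma nat_cases_2:
  obtains "m = 0" | "m = 1" | n where "m = Suc (Suc n)"
  by (metis One_nat_def not0_implies_Suc)

lemma M_extend_fun_add:
  "M_extend (\<lambda>k l m. f k l m + g k l m) v = M_extend f v + M_extend g v"
  by (simp add: M_extend_def case_prod_unfold M.scale_right_distrib sum.distrib)

lemma M_extend_fun_scale: "M_extend (\<lambda>k l m. M_scale c (f k l m)) v = M_scale c (M_extend f v)"
  by (simp add: M_extend_def case_prod_unfold M.scale_sum_right mult.commute)

lemma M_h_conv: "M_h \<mu>\<^sub>1 \<mu>\<^sub>2 a b k l m =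
    M_scale a (M_h \<mu>\<^sub>1 \<mu>\<^sub>2 1 0 k l m) + M_scale b (M_h \<mu>\<^sub>1 \<mu>\<^sub>2 0 1 k l m)"
  by (rule poly_mapping_eqI) (simp add: M_h_def Let_def lookup_add algebra_simps)

lemmas M_gen_defs = M_e1_def M_e2_def M_e12_def M_f1_def M_f2_def M_f12_def M_h_def Let_def

lemma M_commutators:
  shows
    "M_extend (M_e2 \<mu>\<^sub>1 \<mu>\<^sub>2) (M_e1 \<mu>\<^sub>1 \<mu>\<^sub>2 k l m) =
       M_extend (M_e1 \<mu>\<^sub>1 \<mu>\<^sub>2) (M_e2 \<mu>\<^sub>1 \<mu>\<^sub>2 k l m) - M_e12 \<mu>\<^sub>1 \<mu>\<^sub>2 k l m"
    and "M_extend (M_e12 \<mu>\<^sub>1 \<mu>\<^sub>2) (M_e1 \<mu>\<^sub>1 \<mu>\<^sub>2 k l m) =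
       M_extend (M_e1 \<mu>\<^sub>1 \<mu>\<^sub>2) (M_e12 \<mu>\<^sub>1 \<mu>\<^sub>2 k l m)"
    and "M_extend (M_e12 \<mu>\<^sub>1 \<mu>\<^sub>2) (M_e2 \<mu>\<^sub>1 \<mu>\<^sub>2 k l m) =
       M_extend (M_e2 \<mu>\<^sub>1 \<mu>\<^sub>2) (M_e12 \<mu>\<^sub>1 \<mu>\<^sub>2 k l m)"
    and "M_extend (M_f1 \<mu>\<^sub>1 \<mu>\<^sub>2) (M_e1 \<mu>\<^sub>1 \<mu>\<^sub>2 k l m) =
       M_extend (M_e1 \<mu>\<^sub>1 \<mu>\<^sub>2) (M_f1 \<mu>\<^sub>1 \<mu>\<^sub>2 k l m) - M_scale 2 (M_h \<mu>\<^sub>1 \<mu>\<^sub>2 1 0 k l m) + M_h \<mu>\<^sub>1 \<mu>\<^sub>2 0 1 k l m"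
    and "M_extend (M_f1 \<mu>\<^sub>1 \<mu>\<^sub>2) (M_e2 \<mu>\<^sub>1 \<mu>\<^sub>2 k l m) =
       M_extend (M_e2 \<mu>\<^sub>1 \<mu>\<^sub>2) (M_f1 \<mu>\<^sub>1 \<mu>\<^sub>2 k l m)"
    and "M_extend (M_f1 \<mu>\<^sub>1 \<mu>\<^sub>2) (M_e12 \<mu>\<^sub>1 \<mu>\<^sub>2 k l m) =
       M_extend (M_e12 \<mu>\<^sub>1 \<mu>\<^sub>2) (M_f1 \<mu>\<^sub>1 \<mu>\<^sub>2 k l m) + M_e2 \<mu>\<^sub>1 \<mu>\<^sub>2 k l m"
    and "M_extend (M_f2 \<mu>\<^sub>1 \<mu>\<^sub>2) (M_e1 \<mu>\<^sub>1 \<mu>\<^sub>2 k l m) =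
       M_extend (M_e1 \<mu>\<^sub>1 \<mu>\<^sub>2) (M_f2 \<mu>\<^sub>1 \<mu>\<^sub>2 k l m)"
    and "M_extend (M_f2 \<mu>\<^sub>1 \<mu>\<^sub>2) (M_e2 \<mu>\<^sub>1 \<mu>\<^sub>2 k l m) =
       M_extend (M_e2 \<mu>\<^sub>1 \<mu>\<^sub>2) (M_f2 \<mu>\<^sub>1 \<mu>\<^sub>2 k l m) + M_h \<mu>\<^sub>1 \<mu>\<^sub>2 1 0 k l m - M_scale 2 (M_h \<mu>\<^sub>1 \<mu>\<^sub>2 0 1 k l m)"
    and "M_extend (M_f2 \<mu>\<^sub>1 \<mu>\<^sub>2) (M_e12 \<mu>\<^sub>1 \<mu>\<^sub>2 k l m) =
       M_extend (M_e12 \<mu>\<^sub>1 \<mu>\<^sub>2) (M_f2 \<mu>\<^sub>1 \<mu>\<^sub>2 k l m) - M_e1 \<mu>\<^sub>1 \<mu>\<^sub>2 k l m"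
    and "M_extend (M_f2 \<mu>\<^sub>1 \<mu>\<^sub>2) (M_f1 \<mu>\<^sub>1 \<mu>\<^sub>2 k l m) =
       M_extend (M_f1 \<mu>\<^sub>1 \<mu>\<^sub>2) (M_f2 \<mu>\<^sub>1 \<mu>\<^sub>2 k l m) + M_f12 \<mu>\<^sub>1 \<mu>\<^sub>2 k l m"
    and "M_extend (M_f12 \<mu>\<^sub>1 \<mu>\<^sub>2) (M_e1 \<mu>\<^sub>1 \<mu>\<^sub>2 k l m) =
       M_extend (M_e1 \<mu>\<^sub>1 \<mu>\<^sub>2) (M_f12 \<mu>\<^sub>1 \<mu>\<^sub>2 k l m) + M_f2 \<mu>\<^sub>1 \<mu>\<^sub>2 k l m"
    and "M_extend (M_f12 \<mu>\<^sub>1 \<mu>\<^sub>2) (M_e2 \<mu>\<^sub>1 \<mu>\<^sub>2 k l m) =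
       M_extend (M_e2 \<mu>\<^sub>1 \<mu>\<^sub>2) (M_f12 \<mu>\<^sub>1 \<mu>\<^sub>2 k l m) - M_f1 \<mu>\<^sub>1 \<mu>\<^sub>2 k l m"
    and "M_extend (M_f12 \<mu>\<^sub>1 \<mu>\<^sub>2) (M_e12 \<mu>\<^sub>1 \<mu>\<^sub>2 k l m) =
       M_extend (M_e12 \<mu>\<^sub>1 \<mu>\<^sub>2) (M_f12 \<mu>\<^sub>1 \<mu>\<^sub>2 k l m) - M_h \<mu>\<^sub>1 \<mu>\<^sub>2 1 0 k l m - M_h \<mu>\<^sub>1 \<mu>\<^sub>2 0 1 k l m"
    and "M_extend (M_f12 \<mu>\<^sub>1 \<mu>\<^sub>2) (M_f1 \<mu>\<^sub>1 \<mu>\<^sub>2 k l m) =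
       M_extend (M_f1 \<mu>\<^sub>1 \<mu>\<^sub>2) (M_f12 \<mu>\<^sub>1 \<mu>\<^sub>2 k l m)"
    and "M_extend (M_f12 \<mu>\<^sub>1 \<mu>\<^sub>2) (M_f2 \<mu>\<^sub>1 \<mu>\<^sub>2 k l m) =
       M_extend (M_f2 \<mu>\<^sub>1 \<mu>\<^sub>2) (M_f12 \<mu>\<^sub>1 \<mu>\<^sub>2 k l m)"
    and "M_extend (M_h \<mu>\<^sub>1 \<mu>\<^sub>2 1 0) (M_e1 \<mu>\<^sub>1 \<mu>\<^sub>2 k l m) =
       M_extend (M_e1 \<mu>\<^sub>1 \<mu>\<^sub>2) (M_h \<mu>\<^sub>1 \<mu>\<^sub>2 1 0 k l m) + M_e1 \<mu>\<^sub>1 \<mu>\<^sub>2 k l m"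
    and "M_extend (M_h \<mu>\<^sub>1 \<mu>\<^sub>2 1 0) (M_e2 \<mu>\<^sub>1 \<mu>\<^sub>2 k l m) =
       M_extend (M_e2 \<mu>\<^sub>1 \<mu>\<^sub>2) (M_h \<mu>\<^sub>1 \<mu>\<^sub>2 1 0 k l m)"
    and "M_extend (M_h \<mu>\<^sub>1 \<mu>\<^sub>2 1 0) (M_e12 \<mu>\<^sub>1 \<mu>\<^sub>2 k l m) =
       M_extend (M_e12 \<mu>\<^sub>1 \<mu>\<^sub>2) (M_h \<mu>\<^sub>1 \<mu>\<^sub>2 1 0 k l m) + M_e12 \<mu>\<^sub>1 \<mu>\<^sub>2 k l m"
    and "M_extend (M_h \<mu>\<^sub>1 \<mu>\<^sub>2 1 0) (M_f1 \<mu>\<^sub>1 \<mu>\<^sub>2 k l m) =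
       M_extend (M_f1 \<mu>\<^sub>1 \<mu>\<^sub>2) (M_h \<mu>\<^sub>1 \<mu>\<^sub>2 1 0 k l m) - M_f1 \<mu>\<^sub>1 \<mu>\<^sub>2 k l m"
    and "M_extend (M_h \<mu>\<^sub>1 \<mu>\<^sub>2 1 0) (M_f2 \<mu>\<^sub>1 \<mu>\<^sub>2 k l m) =
       M_extend (M_f2 \<mu>\<^sub>1 \<mu>\<^sub>2) (M_h \<mu>\<^sub>1 \<mu>\<^sub>2 1 0 k l m)"
    and "M_extend (M_h \<mu>\<^sub>1 \<mu>\<^sub>2 1 0) (M_f12 \<mu>\<^sub>1 \<mu>\<^sub>2 k l m) =
       M_extend (M_f12 \<mu>\<^sub>1 \<mu>\<^sub>2) (M_h \<mu>\<^sub>1 \<mu>\<^sub>2 1 0 k l m) - M_f12 \<mu>\<^sub>1 \<mu>\<^sub>2 k l m"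
    and "M_extend (M_h \<mu>\<^sub>1 \<mu>\<^sub>2 0 1) (M_e1 \<mu>\<^sub>1 \<mu>\<^sub>2 k l m) =
       M_extend (M_e1 \<mu>\<^sub>1 \<mu>\<^sub>2) (M_h \<mu>\<^sub>1 \<mu>\<^sub>2 0 1 k l m)"
    and "M_extend (M_h \<mu>\<^sub>1 \<mu>\<^sub>2 0 1) (M_e2 \<mu>\<^sub>1 \<mu>\<^sub>2 k l m) =
       M_extend (M_e2 \<mu>\<^sub>1 \<mu>\<^sub>2) (M_h \<mu>\<^sub>1 \<mu>\<^sub>2 0 1 k l m) + M_e2 \<mu>\<^sub>1 \<mu>\<^sub>2 k l m"
    and "M_extend (M_h \<mu>\<^sub>1 \<mu>\<^sub>2 0 1) (M_e12 \<mu>\<^sub>1 \<mu>\<^sub>2 k l m) =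
       M_extend (M_e12 \<mu>\<^sub>1 \<mu>\<^sub>2) (M_h \<mu>\<^sub>1 \<mu>\<^sub>2 0 1 k l m) + M_e12 \<mu>\<^sub>1 \<mu>\<^sub>2 k l m"
    and "M_extend (M_h \<mu>\<^sub>1 \<mu>\<^sub>2 0 1) (M_f1 \<mu>\<^sub>1 \<mu>\<^sub>2 k l m) =
       M_extend (M_f1 \<mu>\<^sub>1 \<mu>\<^sub>2) (M_h \<mu>\<^sub>1 \<mu>\<^sub>2 0 1 k l m)"
    and "M_extend (M_h \<mu>\<^sub>1 \<mu>\<^sub>2 0 1) (M_f2 \<mu>\<^sub>1 \<mu>\<^sub>2 k l m) =
       M_extend (M_f2 \<mu>\<^sub>1 \<mu>\<^sub>2) (M_h \<mu>\<^sub>1 \<mu>\<^sub>2 0 1 k l m) - M_f2 \<mu>\<^sub>1 \<mu>\<^sub>2 k l m"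
    and "M_extend (M_h \<mu>\<^sub>1 \<mu>\<^sub>2 0 1) (M_f12 \<mu>\<^sub>1 \<mu>\<^sub>2 k l m) =
       M_extend (M_f12 \<mu>\<^sub>1 \<mu>\<^sub>2) (M_h \<mu>\<^sub>1 \<mu>\<^sub>2 0 1 k l m) - M_f12 \<mu>\<^sub>1 \<mu>\<^sub>2 k l m"
    and "M_extend (M_h \<mu>\<^sub>1 \<mu>\<^sub>2 0 1) (M_h \<mu>\<^sub>1 \<mu>\<^sub>2 1 0 k l m) =
       M_extend (M_h \<mu>\<^sub>1 \<mu>\<^sub>2 1 0) (M_h \<mu>\<^sub>1 \<mu>\<^sub>2 0 1 k l m)"
  by (cases m rule: nat_cases_2; rule poly_mapping_eqI;
      simp add: M_gen_defs M_extend_add M_extend_scale M_extend_neg M_extend_diff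
        lookup_add lookup_minus; (simp add: algebra_simps)?)+

lemma M_act_expand: "M_act \<mu>\<^sub>1 \<mu>\<^sub>2 X v =
M_scale (X$1$2) (M_extend (M_e1 \<mu>\<^sub>1 \<mu>\<^sub>2) v)
     + M_scale (X$2$3) (M_extend (M_e2 \<mu>\<^sub>1 \<mu>\<^sub>2) v)
     + M_scale (X$1$3) (M_extend (M_e12 \<mu>\<^sub>1 \<mu>\<^sub>2) v)
     + M_scale (X$2$1) (M_extend (M_f1 \<mu>\<^sub>1 \<mu>\<^sub>2) v)
     + M_scale (X$3$2) (M_extend (M_f2 \<mu>\<^sub>1 \<mu>\<^sub>2) v)
     + M_scale (X$3$1) (M_extend (M_f12 \<mu>\<^sub>1 \<mu>\<^sub>2) v)
     + M_scale (X$1$1 - X$2$2) (M_extend (M_h \<mu>\<^sub>1 \<mu>\<^sub>2 1 0) v)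
     + M_scale (X$2$2 - X$3$3) (M_extend (M_h \<mu>\<^sub>1 \<mu>\<^sub>2 0 1) v)"
  unfolding M_act_def M_act_basis_def[abs_def] M_h_conv[of _ _ "X$1$1 - X$2$2"]
  by (simp add: M_extend_fun_add M_extend_fun_scale add.assoc)

lemma M_act_bracket_basis:
  assumes "X \<in> sl3" "Y \<in> sl3"
  shows "M_act \<mu>\<^sub>1 \<mu>\<^sub>2 (lie_bracket X Y) (u k l m) =
    M_act \<mu>\<^sub>1 \<mu>\<^sub>2 X (M_act \<mu>\<^sub>1 \<mu>\<^sub>2 Y (u k l m)) - M_act \<mu>\<^sub>1 \<mu>\<^sub>2 Y (M_act \<mu>\<^sub>1 \<mu>\<^sub>2 X (u k l m))"
proof -
  have X: "X$3$3 = - X$1$1 - X$2$2" and Y: "Y$3$3 = - Y$1$1 - Y$2$2"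
    using assms by (simp_all add: sl3_def trace_def sum_3 eq_neg_iff_add_eq_0 algebra_simps)
  show ?thesis
    by (rule poly_mapping_eqI)
      (simp add: M_act_expand M_extend_add M_extend_scale M_commutators X Y
        lie_bracket_def matrix_matrix_mult_def sum_3 lookup_add lookup_minus; simp add: algebra_simps)
qed

lemma linear_M_act: "Vector_Spaces.linear M_scale M_scale (M_act \<mu>\<^sub>1 \<mu>\<^sub>2 X)"
  unfolding M_act_def by (rule linear_M_extend)

lemma M_act_add_right: "M_act \<mu>\<^sub>1 \<mu>\<^sub>2 X (v + w) = M_act \<mu>\<^sub>1 \<mu>\<^sub>2 X v + M_act \<mu>\<^sub>1 \<mu>\<^sub>2 X w"
  and M_act_scale_right: "M_act \<mu>\<^sub>1 \<mu>\<^sub>2 X (M_scale c v) = M_scale c (M_act \<mu>\<^sub>1 \<mu>\<^sub>2 X v)"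
  by (simp_all add: M_act_def M_extend_add M_extend_scale)

lemmas M_act_right = M_act_add_right M_act_scale_right

lemma M_act_add_left: "M_act \<mu>\<^sub>1 \<mu>\<^sub>2 (X + Y) v = M_act \<mu>\<^sub>1 \<mu>\<^sub>2 X v + M_act \<mu>\<^sub>1 \<mu>\<^sub>2 Y v"
proof (rule M_eqI[OF linear_M_act])
  show "Vector_Spaces.linear M_scale M_scale (\<lambda>v. M_act \<mu>\<^sub>1 \<mu>\<^sub>2 X v + M_act \<mu>\<^sub>1 \<mu>\<^sub>2 Y v)"
    by unfold_locales (simp_all add: M_act_right M.scale_right_distrib)
  show "M_act \<mu>\<^sub>1 \<mu>\<^sub>2 (X + Y) (u k l m) = M_act \<mu>\<^sub>1 \<mu>\<^sub>2 X (u k l m) + M_act \<mu>\<^sub>1 \<mu>\<^sub>2 Y (u k l m)"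
    for k l m
    by (rule poly_mapping_eqI) (simp add: M_act_def M_basis_defs lookup_add algebra_simps)
qed

lemma M_act_scale_left:
  "M_act \<mu>\<^sub>1 \<mu>\<^sub>2 (map_matrix ((*) c) X) v = M_scale c (M_act \<mu>\<^sub>1 \<mu>\<^sub>2 X v)"
proof (rule M_eqI[OF linear_M_act])
  show "Vector_Spaces.linear M_scale M_scale (\<lambda>v. M_scale c (M_act \<mu>\<^sub>1 \<mu>\<^sub>2 X v))"
    by unfold_locales (simp_all add: M_act_right M.scale_right_distrib mult.commute)
  show "M_act \<mu>\<^sub>1 \<mu>\<^sub>2 (map_matrix ((*) c) X) (u k l m) = M_scale c (M_act \<mu>\<^sub>1 \<mu>\<^sub>2 X (u k l m))"
    for k l m
    by (rule poly_mapping_eqI) (simp add: M_act_def M_basis_defs lookup_add algebra_simps)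
qed

lemma M_act_bracket:
  assumes "X \<in> sl3" "Y \<in> sl3"
  shows "M_act \<mu>\<^sub>1 \<mu>\<^sub>2 (lie_bracket X Y) v =
    M_act \<mu>\<^sub>1 \<mu>\<^sub>2 X (M_act \<mu>\<^sub>1 \<mu>\<^sub>2 Y v) - M_act \<mu>\<^sub>1 \<mu>\<^sub>2 Y (M_act \<mu>\<^sub>1 \<mu>\<^sub>2 X v)"
proof (rule M_eqI[OF linear_M_act _ M_act_bracket_basis[OF assms]])
  show "Vector_Spaces.linear M_scale M_scale
      (\<lambda>v. M_act \<mu>\<^sub>1 \<mu>\<^sub>2 X (M_act \<mu>\<^sub>1 \<mu>\<^sub>2 Y v) - M_act \<mu>\<^sub>1 \<mu>\<^sub>2 Y (M_act \<mu>\<^sub>1 \<mu>\<^sub>2 X v))"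
    by unfold_locales (simp_all add: M_act_right M.scale_right_diff_distrib)
qed

lemma lie_module_M: "lie_module sl3 M_scale (M_act \<mu>\<^sub>1 \<mu>\<^sub>2)"
  unfolding lie_module_def
  using vector_space_M_scale linear_M_act M_act_add_left M_act_scale_left M_act_bracket by blast

end

theory Submission
  imports Defs
begin

text \<open>
  If \<open>\<mu>\<^sub>1\<close> is an integer, the coefficient \<open>kb\<close> of every term lowering \<open>k\<close> vanishes at \<open>k = \<mu>\<^sub>1\<close>, so the
  \<open>u k l m\<close> with \<open>k \<ge> \<mu>\<^sub>1\<close> span a proper submodule; likewise for \<open>\<mu>\<^sub>2\<close> and \<open>l\<close>. Otherwise, let \<open>S\<close> be
  a nonzero submodule. Applying \<open>e\<^sub>1\<^sub>2\<close> to a nonzero vector of \<open>S\<close> until just before it dies, and then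
  separating weights, gives some \<open>u k l 0\<close> in \<open>S\<close>. On these vectors \<open>e\<^sub>1\<close>, \<open>e\<^sub>2\<close> lower \<open>k\<close>, \<open>l\<close>, while
  \<open>e\<^sub>2 f\<^sub>1\<^sub>2 - (kb + lb) f\<^sub>1\<close> and \<open>e\<^sub>1 f\<^sub>1\<^sub>2 + (kb + lb) f\<^sub>2\<close> raise them with coefficients \<open>- kb (kb - 1)\<close>
  and \<open>lb (lb - 1)\<close>. Finally \<open>f\<^sub>1\<^sub>2\<close> raises \<open>m\<close> with coefficient \<open>kb + lb + m\<close>, which is nonzero
  because \<open>\<mu>\<^sub>1 + \<mu>\<^sub>2\<close> is not an integer.
\<close>

lemma u_neq_0 [simp]: "u k l m \<noteq> 0"
  unfolding u_def by (metis lookup_single_eq lookup_zero zero_neq_one)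

lemma of_int_diff_neq_0: "(\<mu> :: complex) \<notin> \<int> \<Longrightarrow> of_int i - \<mu> \<noteq> 0"
  by auto

lemma subspace_containing_u:
  assumes "M.subspace S" "\<And>k l m. u k l m \<in> S"
  shows "S = UNIV"
proof -
  have "v \<in> S" for v
  proof -
    have "M_extend u v \<in> S"
      unfolding M_extend_def case_prod_unfold
      by (intro M.subspace_sum M.subspace_scale assms)
    then show ?thesis by (simp add: M_extend_id)
  qed
  then show ?thesis by blast
qed

subsection \<open>Submodules spanned by basis vectors\<close>

definition supported_on :: "(int \<times> int \<times> nat) set \<Rightarrow> M_space set"
  where "supported_on A = {v. Poly_Mapping.keys v \<subseteq> A}"

lemma subspace_supported_on: "M.subspace (supported_on A)"
  unfolding supported_on_def
  by (rule M.subspaceI) (auto simp: in_keys_iff lookup_add dest: subsetD[OF Poly_Mapping.keys_add])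

text \<open>The alternative \<open>c = 0\<close> serves boundary terms: in
  \<open>not_simple_M\<close> the action can carry an index out of the half-space, but only with a
  coefficient that vanishes there.\<close>

lemma scale_u_supported_on: "c = 0 \<or> (k, l, m) \<in> A \<Longrightarrow> M_scale c (u k l m) \<in> supported_on A"
  by (auto simp: supported_on_def in_keys_iff u_def lookup_single when_def split: if_splits)

lemma lie_submodule_supported_on:
  assumes "\<And>X k l m. (k, l, m) \<in> A \<Longrightarrow> M_act_basis \<mu>\<^sub>1 \<mu>\<^sub>2 X k l m \<in> supported_on A"
  shows "lie_submodule sl3 M_scale (M_act \<mu>\<^sub>1 \<mu>\<^sub>2) (supported_on A)"
  unfolding lie_submodule_def
proof (intro conjI ballI)
  fix X v assume "v \<in> supported_on A"
  then have keys: "Poly_Mapping.keys v \<subseteq> A" by (simp add: supported_on_def)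
  show "M_act \<mu>\<^sub>1 \<mu>\<^sub>2 X v \<in> supported_on A"
    unfolding M_act_def M_extend_def case_prod_unfold
    by (intro M.subspace_sum M.subspace_scale subspace_supported_on assms)
      (use keys in \<open>auto dest: subsetD\<close>)
qed (rule subspace_supported_on)

lemma not_simple_if_stable_support:
  assumes "\<And>X k l m. (k, l, m) \<in> A \<Longrightarrow> M_act_basis \<mu>\<^sub>1 \<mu>\<^sub>2 X k l m \<in> supported_on A"
    and "(k, l, m) \<in> A" "(k', l', m') \<notin> A"
  shows "\<not> simple_lie_module sl3 M_scale (M_act \<mu>\<^sub>1 \<mu>\<^sub>2)"
proof
  assume "simple_lie_module sl3 M_scale (M_act \<mu>\<^sub>1 \<mu>\<^sub>2)"
  then have "supported_on A = {0} \<or> supported_on A = UNIV"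
    using lie_submodule_supported_on[of A \<mu>\<^sub>1 \<mu>\<^sub>2] assms(1)
    unfolding simple_lie_module_def by blast
  moreover have "u k l m \<in> supported_on A" "u k' l' m' \<notin> supported_on A"
    using assms(2,3) by (simp_all add: supported_on_def u_def)
  ultimately show False
    by (metis UNIV_I singletonD u_neq_0)
qed

lemma not_simple_M:
  assumes "\<mu>\<^sub>1 \<in> \<int> \<or> \<mu>\<^sub>2 \<in> \<int>"
  shows "\<not> simple_lie_module sl3 M_scale (M_act \<mu>\<^sub>1 \<mu>\<^sub>2)"
proof -
  consider n where "\<mu>\<^sub>1 = of_int n" | n where "\<mu>\<^sub>2 = of_int n"
    using assms by (auto elim: Ints_cases)
  then show ?thesis
  proof cases
    case 1
    let ?A = "{(k :: int, l :: int, m :: nat). n \<le> k}"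
    show ?thesis
    proof (rule not_simple_if_stable_support)
      show "M_act_basis \<mu>\<^sub>1 \<mu>\<^sub>2 X k l m \<in> supported_on ?A" if "(k, l, m) \<in> ?A" for X k l m
        unfolding M_basis_defs M.scale_right_distrib M.scale_scale
        by (intro M.subspace_add subspace_supported_on scale_u_supported_on)
          (use that in \<open>auto simp: 1\<close>)
      show "(n, 0, 0) \<in> ?A" "(n - 1, 0, 0) \<notin> ?A"
        by simp_all
    qed
  next
    case 2
    let ?A = "{(k :: int, l :: int, m :: nat). n \<le> l}"
    show ?thesis
    proof (rule not_simple_if_stable_support)
      show "M_act_basis \<mu>\<^sub>1 \<mu>\<^sub>2 X k l m \<in> supported_on ?A" if "(k, l, m) \<in> ?A" for X k l m
        unfolding M_basis_defs M.scale_right_distrib M.scale_scale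
        by (intro M.subspace_add subspace_supported_on scale_u_supported_on)
          (use that in \<open>auto simp: 2\<close>)
      show "(0, n, 0) \<in> ?A" "(0, n - 1, 0) \<notin> ?A"
        by simp_all
    qed
  qed
qed

subsection \<open>Nonzero submodules\<close>

lemma lookup_M_extend_e12:
  "Poly_Mapping.lookup (M_extend (M_e12 \<mu>\<^sub>1 \<mu>\<^sub>2) v) (k, l, m) =
    - of_nat (Suc m) * Poly_Mapping.lookup v (k, l, Suc m)"
proof -
  \<comment> \<open>With the only contributing index inserted, the sum collapses to it even if it is
    not a key of \<open>v\<close>; the coefficient is then 0.\<close>
  let ?A = "insert (k, l, Suc m) (Poly_Mapping.keys v)"
  have "Poly_Mapping.lookup (M_extend (M_e12 \<mu>\<^sub>1 \<mu>\<^sub>2) v) (k, l, m) =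
      (\<Sum>i\<in>?A. if i = (k, l, Suc m)
        then - of_nat (Suc m) * Poly_Mapping.lookup v (k, l, Suc m) else 0)"
    unfolding M_extend_superset[of ?A v, OF _ subset_insertI, simplified] lookup_sum
    by (intro sum.cong refl)
      (auto simp: M_e12_def u_def lookup_single when_def simp del: of_nat_Suc split: if_splits)
  then show ?thesis by simp
qed

lemma lookup_M_extend_h:
  "Poly_Mapping.lookup (M_extend (M_h \<mu>\<^sub>1 \<mu>\<^sub>2 a b) v) (k, l, m) =
    - ((of_int k - \<mu>\<^sub>1 + of_nat m) * a + (of_int l - \<mu>\<^sub>2 + of_nat m) * b)
      * Poly_Mapping.lookup v (k, l, m)"
proof -
  let ?A = "insert (k, l, m) (Poly_Mapping.keys v)"
  have "Poly_Mapping.lookup (M_extend (M_h \<mu>\<^sub>1 \<mu>\<^sub>2 a b) v) (k, l, m) =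
      (\<Sum>i\<in>?A. if i = (k, l, m)
        then - ((of_int k - \<mu>\<^sub>1 + of_nat m) * a + (of_int l - \<mu>\<^sub>2 + of_nat m) * b)
          * Poly_Mapping.lookup v (k, l, m) else 0)"
    unfolding M_extend_superset[of ?A v, OF _ subset_insertI, simplified] lookup_sum
    by (intro sum.cong refl)
      (auto simp: M_h_def Let_def u_def lookup_single when_def split: if_splits)
  then show ?thesis by simp
qed

context
  fixes \<mu>\<^sub>1 \<mu>\<^sub>2 :: complex and S :: "M_space set"
  assumes submodule: "lie_submodule sl3 M_scale (M_act \<mu>\<^sub>1 \<mu>\<^sub>2) S"
begin

lemma subspace_S: "M.subspace S"
  using submodule by (simp add: lie_submodule_def)

lemmas S_closed = M.subspace_add[OF subspace_S] M.subspace_diff[OF subspace_S]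
  M.subspace_scale[OF subspace_S]

lemma scale_in_S_D: "M_scale c v \<in> S \<Longrightarrow> c \<noteq> 0 \<Longrightarrow> v \<in> S"
  using M.subspace_scale[OF subspace_S, of "M_scale c v" "inverse c"] by simp

lemma S_generators:
  assumes "v \<in> S"
  shows "M_extend (M_e1 \<mu>\<^sub>1 \<mu>\<^sub>2) v \<in> S" "M_extend (M_e2 \<mu>\<^sub>1 \<mu>\<^sub>2) v \<in> S"
    "M_extend (M_e12 \<mu>\<^sub>1 \<mu>\<^sub>2) v \<in> S" "M_extend (M_f1 \<mu>\<^sub>1 \<mu>\<^sub>2) v \<in> S"
    "M_extend (M_f2 \<mu>\<^sub>1 \<mu>\<^sub>2) v \<in> S" "M_extend (M_f12 \<mu>\<^sub>1 \<mu>\<^sub>2) v \<in> S"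
    "M_extend (M_h \<mu>\<^sub>1 \<mu>\<^sub>2 1 0) v \<in> S" "M_extend (M_h \<mu>\<^sub>1 \<mu>\<^sub>2 0 1) v \<in> S"
proof -
  define E :: "3 \<Rightarrow> 3 \<Rightarrow> complex^3^3"
    where "E i j = (\<chi> a b. if a = i \<and> b = j then 1 else 0)" for i j
  \<comment> \<open>\<open>H1\<close> and \<open>H2\<close> are the fundamental coweights: traceless
    diagonal matrices on which the simple roots take the values (1, 0) and (0, 1).\<close>
  define H1 :: "complex^3^3"
    where "H1 = (\<chi> a b. if a = b then (if a = 1 then 2/3 else - 1/3) else 0)"
  define H2 :: "complex^3^3"
    where "H2 = (\<chi> a b. if a = b then (if a = 3 then - 2/3 else 1/3) else 0)"
  have act: "M_act \<mu>\<^sub>1 \<mu>\<^sub>2 X v \<in> S" if "X \<in> sl3" for X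
    using submodule assms that by (simp add: lie_submodule_def)
  have E: "E i j \<in> sl3" if "i \<noteq> j" for i j
    using that by (auto simp: E_def sl3_def trace_def intro!: sum.neutral)
  have H: "H1 \<in> sl3" "H2 \<in> sl3"
    by (simp_all add: H1_def H2_def sl3_def trace_def sum_3)
  show "M_extend (M_e1 \<mu>\<^sub>1 \<mu>\<^sub>2) v \<in> S" using act[OF E[of 1 2]] by (simp add: M_act_expand E_def)
  show "M_extend (M_e2 \<mu>\<^sub>1 \<mu>\<^sub>2) v \<in> S" using act[OF E[of 2 3]] by (simp add: M_act_expand E_def)
  show "M_extend (M_e12 \<mu>\<^sub>1 \<mu>\<^sub>2) v \<in> S" using act[OF E[of 1 3]] by (simp add: M_act_expand E_def)
  show "M_extend (M_f1 \<mu>\<^sub>1 \<mu>\<^sub>2) v \<in> S" using act[OF E[of 2 1]] by (simp add: M_act_expand E_def)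
  show "M_extend (M_f2 \<mu>\<^sub>1 \<mu>\<^sub>2) v \<in> S" using act[OF E[of 3 2]] by (simp add: M_act_expand E_def)
  show "M_extend (M_f12 \<mu>\<^sub>1 \<mu>\<^sub>2) v \<in> S" using act[OF E[of 3 1]] by (simp add: M_act_expand E_def)
  show "M_extend (M_h \<mu>\<^sub>1 \<mu>\<^sub>2 1 0) v \<in> S" using act[OF H(1)] by (simp add: M_act_expand H1_def)
  show "M_extend (M_h \<mu>\<^sub>1 \<mu>\<^sub>2 0 1) v \<in> S" using act[OF H(2)] by (simp add: M_act_expand H2_def)
qed

section \<open>Finding a basis vector of degree 0 in a nonzero submodule\<close>

lemma ex_degree_0_in_S:
  assumes "v \<in> S" "v \<noteq> 0" "\<And>k l m. (k, l, m) \<in> Poly_Mapping.keys v \<Longrightarrow> m \<le> N"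
  shows "\<exists>w\<in>S. w \<noteq> 0 \<and> (\<forall>(k, l, m)\<in>Poly_Mapping.keys w. m = 0)"
  using assms
proof (induction N arbitrary: v)
  case 0
  then show ?case by (intro bexI[of _ v]) auto
next
  case (Suc N)
  let ?w = "M_extend (M_e12 \<mu>\<^sub>1 \<mu>\<^sub>2) v"
  show ?case
  proof (cases "?w = 0")
    case True
    \<comment> \<open>Up to a nonzero factor, each coefficient of \<open>v\<close> in positive
      degree is a coefficient of \<open>?w\<close>. So \<open>?w = 0\<close> forces \<open>v\<close>
      itself to have degree 0.\<close>
    have "Poly_Mapping.lookup v (k, l, Suc m) = 0" for k l m
      using lookup_M_extend_e12[of \<mu>\<^sub>1 \<mu>\<^sub>2 v k l m] True by (simp del: of_nat_Suc)
    then have "m = 0" if "(k, l, m) \<in> Poly_Mapping.keys v" for k l m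
      using that by (cases m) (auto simp: in_keys_iff)
    then show ?thesis using Suc.prems by blast
  next
    case False
    moreover have "m \<le> N" if "(k, l, m) \<in> Poly_Mapping.keys ?w" for k l m
    proof -
      have "(k, l, Suc m) \<in> Poly_Mapping.keys v"
        using that by (auto simp: in_keys_iff lookup_M_extend_e12)
      then show ?thesis using Suc.prems(3) by blast
    qed
    ultimately show ?thesis
      using Suc.IH S_generators(3)[OF Suc.prems(1)] by blast
  qed
qed

text \<open>In degree 0 the weight determines \<open>(k, l)\<close>, so the Cartan subalgebra can
  remove one term of \<open>v\<close> while keeping another. The restriction on the degree matters:
  \<open>u k l (Suc m)\<close> and \<open>u (k + 1) (l + 1) m\<close> have the same weight.\<close>

lemma ex_u_in_S_of_degree_0:
  assumes "v \<in> S" "v \<noteq> 0" "\<forall>(k, l, m)\<in>Poly_Mapping.keys v. m = 0"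
  shows "\<exists>k l. u k l 0 \<in> S"
  using assms
proof (induction "card (Poly_Mapping.keys v)" arbitrary: v rule: less_induct)
  case less
  obtain k l where kl: "(k, l, 0) \<in> Poly_Mapping.keys v"
    using less.prems(2,3) by (fastforce simp flip: keys_eq_empty)
  show ?case
  proof (cases "Poly_Mapping.keys v = {(k, l, 0)}")
    case True
    then have "v = M_scale (Poly_Mapping.lookup v (k, l, 0)) (u k l 0)"
      using M_extend_id[of v] by (simp add: M_extend_def)
    then have "u k l 0 \<in> S"
      using kl less.prems(1) scale_in_S_D by (metis in_keys_iff)
    then show ?thesis by blast
  next
    case False
    then obtain k' l' m' where "(k', l', m') \<in> Poly_Mapping.keys v" "(k', l', m') \<noteq> (k, l, 0)"
      using kl by (metis empty_iff prod_cases3 subsetI subset_singletonD singleton_iff)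
    moreover from this have "m' = 0"
      using less.prems(3) by blast
    ultimately have kl': "(k', l', 0) \<in> Poly_Mapping.keys v" "(k', l') \<noteq> (k, l)"
      by auto
    \<comment> \<open>These are the root values of a Cartan element that tells
      \<open>(k', l')\<close> from \<open>(k, l)\<close>: by the first coordinate if it differs,
      else by the second.\<close>
    define a b :: complex where "a = (if k' = k then 0 else 1)" and "b = (if k' = k then 1 else 0)"
    \<comment> \<open>The added scalar is minus the eigenvalue on \<open>u k l 0\<close>, so the
      term at \<open>(k, l, 0)\<close> dies and the one at \<open>(k', l', 0)\<close>
      survives.\<close>
    define w where "w = M_extend (M_h \<mu>\<^sub>1 \<mu>\<^sub>2 a b) v
      + M_scale ((of_int k - \<mu>\<^sub>1) * a + (of_int l - \<mu>\<^sub>2) * b) v"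
    have "w \<in> S"
      using S_generators(7,8)[OF less.prems(1)] less.prems(1)
      by (auto simp: w_def a_def b_def intro!: S_closed)
    moreover have lookup_w: "Poly_Mapping.lookup w (i, j, 0) =
      (of_int (k - i) * a + of_int (l - j) * b) * Poly_Mapping.lookup v (i, j, 0)" for i j
      unfolding w_def lookup_add lookup_M_extend_h lookup_M_scale by (simp add: algebra_simps)
    have sub: "Poly_Mapping.keys w \<subseteq> Poly_Mapping.keys v"
      by (auto simp: w_def in_keys_iff lookup_add lookup_M_extend_h)
    moreover have "(k, l, 0) \<notin> Poly_Mapping.keys w"
      by (simp add: in_keys_iff lookup_w)
    ultimately have "card (Poly_Mapping.keys w) < card (Poly_Mapping.keys v)"
      using kl by (intro psubset_card_mono) auto
    moreover have "(k', l', 0) \<in> Poly_Mapping.keys w"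
      using kl' by (auto simp: in_keys_iff lookup_w a_def b_def)
    then have "w \<noteq> 0" by auto
    ultimately show ?thesis
      using less.hyps \<open>w \<in> S\<close> sub less.prems(3) by blast
  qed
qed

lemma ex_u_in_S:
  assumes "S \<noteq> {0}"
  shows "\<exists>k l. u k l 0 \<in> S"
proof -
  obtain v where v: "v \<in> S" "v \<noteq> 0"
    using assms M.subspace_0[OF subspace_S] by blast
  have "m \<le> Max ((\<lambda>(k, l, m). m) ` Poly_Mapping.keys v)"
    if "(k, l, m) \<in> Poly_Mapping.keys v" for k l m
    using that by (intro Max_ge) force+
  then show ?thesis
    using ex_degree_0_in_S[OF v] ex_u_in_S_of_degree_0 by blast
qed

section \<open>Reaching every basis vector from one of degree 0\<close>

lemma u_pred_in_S:
  assumes "u k l 0 \<in> S"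
  shows "\<mu>\<^sub>1 \<notin> \<int> \<Longrightarrow> u (k - 1) l 0 \<in> S" and "\<mu>\<^sub>2 \<notin> \<int> \<Longrightarrow> u k (l - 1) 0 \<in> S"
proof -
  have "M_scale (of_int k - \<mu>\<^sub>1) (u (k - 1) l 0) \<in> S"
    using M.subspace_neg[OF subspace_S S_generators(1)[OF assms]] by (simp add: M_e1_def)
  then show "u (k - 1) l 0 \<in> S" if "\<mu>\<^sub>1 \<notin> \<int>"
    by (rule scale_in_S_D) (use of_int_diff_neq_0[OF that, of k] in simp)
  \<comment> \<open>In degree 0 the second term of \<open>M_e2\<close> has coefficient 0.\<close>
  have "M_scale (of_int l - \<mu>\<^sub>2) (u k (l - 1) 0) \<in> S"
    using M.subspace_neg[OF subspace_S S_generators(2)[OF assms]] by (simp add: M_e2_def)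
  then show "u k (l - 1) 0 \<in> S" if "\<mu>\<^sub>2 \<notin> \<int>"
    by (rule scale_in_S_D) (use of_int_diff_neq_0[OF that, of l] in simp)
qed

lemma u_succ_in_S:
  assumes "u k l 0 \<in> S"
  shows "\<mu>\<^sub>1 \<notin> \<int> \<Longrightarrow> u (k + 1) l 0 \<in> S" and "\<mu>\<^sub>2 \<notin> \<int> \<Longrightarrow> u k (l + 1) 0 \<in> S"
proof -
  define kb lb where "kb = of_int k - \<mu>\<^sub>1" and "lb = of_int l - \<mu>\<^sub>2"
  note f12 = S_generators(6)[OF assms]
  \<comment> \<open>\<open>M_f1\<close> alone would leave a term in degree 1. Both parts of the
    difference contain \<open>- lb * (kb + lb)\<close> times \<open>u k (l - 1) 1\<close>, which
    cancels.\<close>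
  have "M_extend (M_e2 \<mu>\<^sub>1 \<mu>\<^sub>2) (M_extend (M_f12 \<mu>\<^sub>1 \<mu>\<^sub>2) (u k l 0))
      - M_scale (kb + lb) (M_extend (M_f1 \<mu>\<^sub>1 \<mu>\<^sub>2) (u k l 0)) \<in> S"
    by (intro S_closed S_generators f12 assms)
  also have "M_extend (M_e2 \<mu>\<^sub>1 \<mu>\<^sub>2) (M_extend (M_f12 \<mu>\<^sub>1 \<mu>\<^sub>2) (u k l 0))
      - M_scale (kb + lb) (M_extend (M_f1 \<mu>\<^sub>1 \<mu>\<^sub>2) (u k l 0))
      = M_scale (- (kb * (kb - 1))) (u (k + 1) l 0)"
    by (rule poly_mapping_eqI)
      (simp add: M_gen_defs M_extend_add M_extend_scale M_extend_neg lookup_add lookup_minus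
        kb_def lb_def; simp add: algebra_simps)
  finally have k: "M_scale (- (kb * (kb - 1))) (u (k + 1) l 0) \<in> S" .
  \<comment> \<open>Here the coefficients of \<open>u (k - 1) l 1\<close> are opposite,
    \<open>- kb * (kb + lb)\<close> and \<open>kb * (kb + lb)\<close>, hence the plus sign.\<close>
  have "M_extend (M_e1 \<mu>\<^sub>1 \<mu>\<^sub>2) (M_extend (M_f12 \<mu>\<^sub>1 \<mu>\<^sub>2) (u k l 0))
      + M_scale (kb + lb) (M_extend (M_f2 \<mu>\<^sub>1 \<mu>\<^sub>2) (u k l 0)) \<in> S"
    by (intro S_closed S_generators f12 assms)
  also have "M_extend (M_e1 \<mu>\<^sub>1 \<mu>\<^sub>2) (M_extend (M_f12 \<mu>\<^sub>1 \<mu>\<^sub>2) (u k l 0))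
      + M_scale (kb + lb) (M_extend (M_f2 \<mu>\<^sub>1 \<mu>\<^sub>2) (u k l 0))
      = M_scale (lb * (lb - 1)) (u k (l + 1) 0)"
    by (rule poly_mapping_eqI)
      (simp add: M_gen_defs M_extend_add M_extend_scale M_extend_neg lookup_add lookup_minus
        kb_def lb_def; simp add: algebra_simps)
  finally have l: "M_scale (lb * (lb - 1)) (u k (l + 1) 0) \<in> S" .
  show "u (k + 1) l 0 \<in> S" if "\<mu>\<^sub>1 \<notin> \<int>"
  proof (rule scale_in_S_D[OF k])
    have "kb \<noteq> 0" "kb - 1 \<noteq> 0"
      using of_int_diff_neq_0[OF that, of k] of_int_diff_neq_0[OF that, of "k - 1"]
      by (simp_all add: kb_def algebra_simps)
    then show "- (kb * (kb - 1)) \<noteq> 0" by simp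
  qed
  show "u k (l + 1) 0 \<in> S" if "\<mu>\<^sub>2 \<notin> \<int>"
  proof (rule scale_in_S_D[OF l])
    have "lb \<noteq> 0" "lb - 1 \<noteq> 0"
      using of_int_diff_neq_0[OF that, of l] of_int_diff_neq_0[OF that, of "l - 1"]
      by (simp_all add: lb_def algebra_simps)
    then show "lb * (lb - 1) \<noteq> 0" by simp
  qed
qed

text \<open>\<open>M_f12\<close> also yields a multiple of \<open>u (k + 1) (l + 1) m\<close>;
  having this vector in \<open>S\<close> allows subtracting it.\<close>

lemma u_succ_degree_in_S:
  assumes "\<mu>\<^sub>1 + \<mu>\<^sub>2 \<notin> \<int>" "u k l m \<in> S" "u (k + 1) (l + 1) m \<in> S"
  shows "u k l (Suc m) \<in> S"
proof -
  define c where "c = of_int k - \<mu>\<^sub>1 + (of_int l - \<mu>\<^sub>2) + of_nat m"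
  have "M_extend (M_f12 \<mu>\<^sub>1 \<mu>\<^sub>2) (u k l m) - M_scale (of_int l - \<mu>\<^sub>2) (u (k + 1) (l + 1) m) \<in> S"
    by (intro S_closed S_generators assms)
  then have "M_scale c (u k l (Suc m)) \<in> S"
    by (simp add: M_gen_defs c_def)
  moreover have "c \<noteq> 0"
  proof
    assume "c = 0"
    then have "\<mu>\<^sub>1 + \<mu>\<^sub>2 = of_int (k + l + int m)"
      by (simp add: c_def algebra_simps)
    then show False using assms(1) by simp
  qed
  ultimately show ?thesis by (rule scale_in_S_D)
qed

lemma S_eq_UNIV:
  assumes "S \<noteq> {0}" "\<mu>\<^sub>1 \<notin> \<int>" "\<mu>\<^sub>2 \<notin> \<int>" "\<mu>\<^sub>1 + \<mu>\<^sub>2 \<notin> \<int>"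
  shows "S = UNIV"
proof (rule subspace_containing_u[OF subspace_S])
  obtain k\<^sub>0 l\<^sub>0 where 0: "u k\<^sub>0 l\<^sub>0 0 \<in> S"
    using ex_u_in_S[OF assms(1)] by blast
  have *: "u k l\<^sub>0 0 \<in> S" for k
    by (induction k rule: int_induct[where k = k\<^sub>0]) (use 0 u_succ_in_S u_pred_in_S assms in auto)
  have **: "u k l 0 \<in> S" for k l
    by (induction l rule: int_induct[where k = l\<^sub>0]) (use * u_succ_in_S u_pred_in_S assms in auto)
  \<comment> \<open>The induction keeps \<open>k\<close> and \<open>l\<close> arbitrary because
    raising the degree at \<open>(k, l)\<close> uses the neighbour
    \<open>(k + 1, l + 1)\<close>.\<close>
  show "u k l m \<in> S" for k l m
    by (induction m arbitrary: k l) (use ** u_succ_degree_in_S assms in auto)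
qed

end

theorem theorem6p1:
  fixes \<mu>\<^sub>1 \<mu>\<^sub>2 :: complex
  assumes "\<mu>\<^sub>1 + \<mu>\<^sub>2 \<notin> \<int>"
  shows "simple_lie_module sl3 M_scale (M_act \<mu>\<^sub>1 \<mu>\<^sub>2) \<longleftrightarrow> \<mu>\<^sub>1 \<notin> \<int> \<and> \<mu>\<^sub>2 \<notin> \<int>"
proof
  assume "simple_lie_module sl3 M_scale (M_act \<mu>\<^sub>1 \<mu>\<^sub>2)"
  then show "\<mu>\<^sub>1 \<notin> \<int> \<and> \<mu>\<^sub>2 \<notin> \<int>"
    using not_simple_M by blast
next
  assume "\<mu>\<^sub>1 \<notin> \<int> \<and> \<mu>\<^sub>2 \<notin> \<int>"
  then show "simple_lie_module sl3 M_scale (M_act \<mu>\<^sub>1 \<mu>\<^sub>2)"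
    unfolding simple_lie_module_def
    using lie_module_M S_eq_UNIV[OF _ _ _ _ assms] by (auto intro: exI[of _ "u 0 0 0"])
qed

end
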